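(* The ${\rm D}_s$-optimum design for $\boldsymbol\gamma$ coincides with the ${\rm D}$-optimum design for the "auxiliary" linear regression model $$y_i=\alpha_0+\boldsymbol\alpha^T\nabla\log h(\boldsymbol x_i;\tilde{\boldsymbol\gamma})+\varepsilon_i,\qquad \varepsilon_i\sim N(0;\sigma^2),\quad i=1,\ldots,n,$$ where $\nabla\log h(\boldsymbol x;\boldsymbol\gamma)=\left(\frac{\partial \log h(\boldsymbol x;\boldsymbol\gamma)}{\partial\gamma_1},\ldots,\frac{\partial\log h(\boldsymbol x;\boldsymbol\gamma)}{\partial\gamma_s}\right)^T$ and $\tilde{\boldsymbol\gamma}$ is a nominal value for $\boldsymbol\gamma$.
   Context: Setting. Observations follow the Gaussian regression model $y_i=\mu(\boldsymbol x_i;\boldsymbol\beta)+\varepsilon_i$, $\varepsilon_i\sim N(0;\sigma^2h(\boldsymbol x_i;\boldsymbol\gamma))$, $i=1,\dots,n$, where $\boldsymbol\beta\in\mathbb{R}^m$, $\sigma^2$ is an unknown constant, $\boldsymbol\gamma\in\mathbb{R}^s$, and $h:\mathbb{R}^p\times\mathbb{R}^s\to\mathbb{R}_+$ is a continuous positive function. Experimental points lie in a compact set $\mathcal X\subseteq\mathbb{R}^p$. A design $\xi$ is a discrete probability measure on $\mathcal X$ with support points $\boldsymbol x_1,\dots,\boldsymbol x_k$ and weights $\xi(\boldsymbol x_1),\dots,\xi(\boldsymbol x_k)$. $\nabla\mu$ is the gradient of $\mu$ in $\boldsymbol\beta$, and $\nabla h$ the gradient of $h$ in $\boldsymbol\gamma$.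 The Fisher information matrix of the design for $(\boldsymbol\beta,\sigma^2,\boldsymbol\gamma)$ is $\mathcal I=\begin{bmatrix}\mathcal I_{11}&\mathcal I_{12}\\ \mathcal I_{12}^T&\mathcal I_{22}\end{bmatrix}$ with $$\mathcal I_{11}=\begin{bmatrix}\boldsymbol M&\boldsymbol 0\\ \boldsymbol 0^T&\frac1{2\sigma^4}\end{bmatrix},\quad \boldsymbol M=\sum_{i=1}^k\frac{\nabla\mu(\boldsymbol x_i;\boldsymbol\beta)\nabla\mu(\boldsymbol x_i;\boldsymbol\beta)^T}{\sigma^2h(\boldsymbol x_i;\boldsymbol\gamma)}\xi(\boldsymbol x_i),$$ $$\mathcal I_{12}=\begin{bmatrix}\boldsymbol 0\\ \sum_{i=1}^k\frac{\nabla h(\boldsymbol x_i;\boldsymbol\gamma)^T}{2\sigma^2h(\boldsymbol x_i;\boldsymbol\gamma)}\xi(\boldsymbol x_i)\end{bmatrix},\quad \mathcal I_{22}=\sum_{i=1}^k\frac{\nabla h(\boldsymbol x_i;\boldsymbol\gamma)\nabla h(\boldsymbol x_i;\boldsymbol\gamma)^T}{2h(\boldsymbol x_i;\boldsymbol\gamma)^2}\xi(\boldsymbol x_i),$$ where $\boldsymbol 0$ in $\mathcal I_{12}$ is an $m\times s$ zero block. The asymptotic covariance matrix of the maximum likelihood estimator of $\boldsymbol\gamma$ is $[\mathcal I_{22.1}(\xi;\boldsymbol\gamma)]^{-1}$, where $\mathcal I_{22.1}(\xi;\boldsymbol\gamma)=\mathcal I_{22}-\mathcal I_{12}^T\mathcal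 I_{11}^{-1}\mathcal I_{12}$ is the Schur complement. The ${\rm D}_s$-optimum design for $\boldsymbol\gamma$ is $\arg\max_\xi|\mathcal I_{22.1}(\xi;\boldsymbol\gamma)|$, evaluated at the nominal value $\boldsymbol\gamma=\tilde{\boldsymbol\gamma}$. In the auxiliary model the parameters are $\alpha_0\in\mathbb{R}$ and $\boldsymbol\alpha\in\mathbb{R}^s$, and its ${\rm D}$-optimum design is the one maximizing the determinant $\left|\sum_{i=1}^k \tilde{\boldsymbol f}(\boldsymbol x_i)\tilde{\boldsymbol f}(\boldsymbol x_i)^T\xi(\boldsymbol x_i)\right|$ with $\tilde{\boldsymbol f}(\boldsymbol x)=\left(1,\nabla\log h(\boldsymbol x;\tilde{\boldsymbol\gamma})^T\right)^T$. *)

theory Defs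
  imports "HOL-Probability.Probability"
begin

definition partial_deriv :: "(real ^ 'n::finite \<Rightarrow> real) \<Rightarrow> 'n \<Rightarrow> real ^ 'n \<Rightarrow> real" where
  "partial_deriv f j a = deriv (\<lambda>t. f (a + t *\<^sub>R axis j 1)) 0"

definition gradient :: "(real ^ 'n::finite \<Rightarrow> real) \<Rightarrow> real ^ 'n \<Rightarrow> real ^ 'n" where
  "gradient f a = (\<chi> j. partial_deriv f j a)"

text \<open>\<open>deriv\<close> returns an unspecified value where the derivative does not exist, so existence of the
  partial derivatives has to be required separately.\<close>

definition has_gradient_at :: "(real ^ 'n::finite \<Rightarrow> real) \<Rightarrow> real ^ 'n \<Rightarrow> bool" where
  "has_gradient_at f a \<longleftrightarrow> (\<forall>j. (\<lambda>t. f (a + t *\<^sub>R axis j 1)) differentiable (at 0))"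

definition outer :: "real ^ 'n::finite \<Rightarrow> real ^ 'k::finite \<Rightarrow> real ^ 'k ^ 'n" where
  "outer v w = (\<chi> i j. v $ i * w $ j)"

definition vstack :: "real ^ 'c ^ 'a \<Rightarrow> real ^ 'c ^ 'b \<Rightarrow> real ^ 'c::finite ^ ('a::finite + 'b::finite)" where
  "vstack A B = (\<chi> i. case i of Inl k \<Rightarrow> A $ k | Inr k \<Rightarrow> B $ k)"

definition block_diag ::
    "real ^ 'a ^ 'a \<Rightarrow> real ^ 'b ^ 'b \<Rightarrow> real ^ ('a::finite + 'b::finite) ^ ('a + 'b)" where
  "block_diag A B = (\<chi> i j. case (i, j) of
       (Inl k, Inl l) \<Rightarrow> A $ k $ l
     | (Inr k, Inr l) \<Rightarrow> B $ k $ l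
     | _ \<Rightarrow> 0)"

definition designs :: "(real ^ 'p::finite) set \<Rightarrow> (real ^ 'p) pmf set" where
  "designs X = {\<xi>. finite (set_pmf \<xi>) \<and> set_pmf \<xi> \<subseteq> X}"

definition moment_matrix :: "(real ^ 'p::finite \<Rightarrow> real ^ 'q::finite) \<Rightarrow> (real ^ 'p) pmf \<Rightarrow> real ^ 'q ^ 'q" where
  "moment_matrix f \<xi> = (\<Sum>x\<in>set_pmf \<xi>. pmf \<xi> x *\<^sub>R outer (f x) (f x))"

definition D_optimum :: "(real ^ 'p::finite) set \<Rightarrow> (real ^ 'p \<Rightarrow> real ^ 'q::finite) \<Rightarrow> (real ^ 'p) pmf \<Rightarrow> bool" where
  "D_optimum X f \<xi> \<longleftrightarrow> is_arg_max (\<lambda>\<eta>. det (moment_matrix f \<eta>)) (\<lambda>\<eta>. \<eta> \<in> designs X) \<xi>"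

text \<open>Regressors \<open>(1, \<nabla> log h(x; \<gamma>))\<close> of the auxiliary model; the summand \<open>1\<close> of the
  index type is the one-element type and carries the intercept.\<close>

definition aux_regressor ::
    "(real ^ 'p::finite \<Rightarrow> real ^ 's::finite \<Rightarrow> real) \<Rightarrow> real ^ 's \<Rightarrow> real ^ 'p \<Rightarrow> real ^ (1 + 's)" where
  "aux_regressor h \<gamma> x =
     (\<chi> i. case i of Inl _ \<Rightarrow> 1 | Inr j \<Rightarrow> gradient (\<lambda>g. ln (h x g)) \<gamma> $ j)"

text \<open>The information matrix for \<open>(\<beta>, \<sigma>\<^sup>2, \<gamma>)\<close> is partitioned as \<open>(\<beta>, \<sigma>\<^sup>2)\<close> against \<open>\<gamma>\<close>;
  the index type \<open>'m + 1\<close> is that of \<open>(\<beta>, \<sigma>\<^sup>2)\<close>.\<close>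

definition info_beta ::
    "(real ^ 'p::finite \<Rightarrow> real ^ 'm::finite \<Rightarrow> real) \<Rightarrow> (real ^ 'p \<Rightarrow> real ^ 's::finite \<Rightarrow> real)
     \<Rightarrow> real ^ 'm \<Rightarrow> real \<Rightarrow> real ^ 's \<Rightarrow> (real ^ 'p) pmf \<Rightarrow> real ^ 'm ^ 'm" where
  "info_beta \<mu> h \<beta> \<sigma> \<gamma> \<xi> = (\<Sum>x\<in>set_pmf \<xi>.
     (pmf \<xi> x / (\<sigma>\<^sup>2 * h x \<gamma>)) *\<^sub>R outer (gradient (\<mu> x) \<beta>) (gradient (\<mu> x) \<beta>))"

definition info11 ::
    "(real ^ 'p::finite \<Rightarrow> real ^ 'm::finite \<Rightarrow> real) \<Rightarrow> (real ^ 'p \<Rightarrow> real ^ 's::finite \<Rightarrow> real)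
     \<Rightarrow> real ^ 'm \<Rightarrow> real \<Rightarrow> real ^ 's \<Rightarrow> (real ^ 'p) pmf \<Rightarrow> real ^ ('m + 1) ^ ('m + 1)" where
  "info11 \<mu> h \<beta> \<sigma> \<gamma> \<xi> = block_diag (info_beta \<mu> h \<beta> \<sigma> \<gamma> \<xi>) (mat (1 / (2 * \<sigma> ^ 4)))"

definition info12 ::
    "(real ^ 'p::finite \<Rightarrow> real ^ 's::finite \<Rightarrow> real) \<Rightarrow> real \<Rightarrow> real ^ 's \<Rightarrow> (real ^ 'p) pmf
     \<Rightarrow> real ^ 's ^ ('m::finite + 1)" where
  "info12 h \<sigma> \<gamma> \<xi> = vstack 0
     (rowvector (\<Sum>x\<in>set_pmf \<xi>. (pmf \<xi> x / (2 * \<sigma>\<^sup>2 * h x \<gamma>)) *\<^sub>R gradient (h x) \<gamma>))"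

definition info22 ::
    "(real ^ 'p::finite \<Rightarrow> real ^ 's::finite \<Rightarrow> real) \<Rightarrow> real ^ 's \<Rightarrow> (real ^ 'p) pmf \<Rightarrow> real ^ 's ^ 's" where
  "info22 h \<gamma> \<xi> = (\<Sum>x\<in>set_pmf \<xi>.
     (pmf \<xi> x / (2 * (h x \<gamma>)\<^sup>2)) *\<^sub>R outer (gradient (h x) \<gamma>) (gradient (h x) \<gamma>))"

text \<open>The block \<open>info11\<close> is singular for designs that do not identify \<open>\<beta>\<close> (for instance those with fewer
  than \<open>m\<close> support points), and \<open>matrix_inv\<close> is unspecified there. The inverse used in the Schur
  complement is therefore a parameter: \<open>matrix_inv\<close>, on designs with invertible \<open>info11\<close>, or a
  generalized inverse, on all designs. On invertible matrices every generalized inverse agrees with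
  \<open>matrix_inv\<close>.\<close>

definition generalized_inverse :: "(real ^ 'n::finite ^ 'n \<Rightarrow> real ^ 'n ^ 'n) \<Rightarrow> bool" where
  "generalized_inverse G \<longleftrightarrow> (\<forall>A. A ** G A ** A = A)"

definition info22_1 ::
    "(real ^ ('m + 1) ^ ('m + 1) \<Rightarrow> real ^ ('m + 1) ^ ('m + 1))
     \<Rightarrow> (real ^ 'p::finite \<Rightarrow> real ^ 'm::finite \<Rightarrow> real) \<Rightarrow> (real ^ 'p \<Rightarrow> real ^ 's::finite \<Rightarrow> real)
     \<Rightarrow> real ^ 'm \<Rightarrow> real \<Rightarrow> real ^ 's \<Rightarrow> (real ^ 'p) pmf \<Rightarrow> real ^ 's ^ 's" where
  "info22_1 G \<mu> h \<beta> \<sigma> \<gamma> \<xi> =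
     info22 h \<gamma> \<xi> - transpose (info12 h \<sigma> \<gamma> \<xi>) ** G (info11 \<mu> h \<beta> \<sigma> \<gamma> \<xi>) ** info12 h \<sigma> \<gamma> \<xi>"

definition regular_designs ::
    "(real ^ 'p::finite) set \<Rightarrow> (real ^ 'p \<Rightarrow> real ^ 'm::finite \<Rightarrow> real)
     \<Rightarrow> (real ^ 'p \<Rightarrow> real ^ 's::finite \<Rightarrow> real)
     \<Rightarrow> real ^ 'm \<Rightarrow> real \<Rightarrow> real ^ 's \<Rightarrow> (real ^ 'p) pmf set" where
  "regular_designs X \<mu> h \<beta> \<sigma> \<gamma> = {\<xi> \<in> designs X. invertible (info11 \<mu> h \<beta> \<sigma> \<gamma> \<xi>)}"

definition Ds_optimum ::
    "(real ^ ('m + 1) ^ ('m + 1) \<Rightarrow> real ^ ('m + 1) ^ ('m + 1)) \<Rightarrow> (real ^ 'p) pmf set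
     \<Rightarrow> (real ^ 'p::finite \<Rightarrow> real ^ 'm::finite \<Rightarrow> real) \<Rightarrow> (real ^ 'p \<Rightarrow> real ^ 's::finite \<Rightarrow> real)
     \<Rightarrow> real ^ 'm \<Rightarrow> real \<Rightarrow> real ^ 's \<Rightarrow> (real ^ 'p) pmf \<Rightarrow> bool" where
  "Ds_optimum G \<Xi> \<mu> h \<beta> \<sigma> \<gamma> \<xi> \<longleftrightarrow>
     is_arg_max (\<lambda>\<eta>. det (info22_1 G \<mu> h \<beta> \<sigma> \<gamma> \<eta>)) (\<lambda>\<eta>. \<eta> \<in> \<Xi>) \<xi>"

end

theory Submission
  imports Defs
begin

text \<open>Write \<open>g = \<nabla> log h = \<nabla>h / h\<close>, and let \<open>u\<close> and \<open>S\<close> be the means of \<open>g\<close> and \<open>g g\<^sup>T\<close> under the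
  design. Only the \<open>\<sigma>\<^sup>2\<close> entry of the inverse of the first block meets the nonzero row of \<open>info12\<close>,
  and for every inner inverse it equals \<open>2 \<sigma>\<^sup>4\<close>; hence the Schur complement is \<open>(S - u u\<^sup>T) / 2\<close>. The
  moment matrix of the auxiliary model is \<open>S\<close> bordered by \<open>u\<close> and \<open>1\<close>, with determinant
  \<open>det (S - u u\<^sup>T)\<close>. The two criteria thus differ by the constant factor \<open>2 ^ s\<close>.\<close>

section \<open>Determinants of block matrices indexed by sum types\<close>

lemma sum_sum_type:
  fixes f :: "'a::finite + 'b::finite \<Rightarrow> 'c::comm_monoid_add"
  shows "sum f UNIV = (\<Sum>i\<in>UNIV. f (Inl i)) + (\<Sum>j\<in>UNIV. f (Inr j))"
  unfolding UNIV_Plus_UNIV[symmetric] by (simp add: sum.Plus comp_def del: UNIV_Plus_UNIV)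

lemma prod_sum_type:
  fixes f :: "'a::finite + 'b::finite \<Rightarrow> 'c::comm_monoid_mult"
  shows "prod f UNIV = (\<Prod>i\<in>UNIV. f (Inl i)) * (\<Prod>j\<in>UNIV. f (Inr j))"
  unfolding UNIV_Plus_UNIV[symmetric] by (simp add: prod.Plus comp_def del: UNIV_Plus_UNIV)

text \<open>In the Leibniz expansion, a permutation that moves some \<open>Inl k\<close> picks an
  off-diagonal zero from an identity row. The surviving permutations move only \<open>Inr\<close>
  indices and correspond to those of \<open>'b\<close>.\<close>

lemma det_block_diag_mat_1:
  fixes C :: "real ^ 'b ^ 'b"
  shows "det (block_diag (mat 1 :: real ^ 'a ^ 'a) C) = det C"
proof -
  let ?A = "block_diag (mat 1 :: real ^ 'a ^ 'a) C"
  let ?t = "\<lambda>p. of_int (sign p) * (\<Prod>i\<in>UNIV. ?A $ i $ p i)"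
  let ?R = "range (Inr :: 'b \<Rightarrow> 'a + 'b)"
  let ?m = "map_permutation UNIV (Inr :: 'b \<Rightarrow> 'a + 'b)"
  let ?m' = "map_permutation ?R (inv_into UNIV (Inr :: 'b \<Rightarrow> 'a + 'b))"
  have bij: "bij_betw Inr UNIV ?R"
    by (simp add: bij_betw_def)
  then have bij': "bij_betw (inv_into UNIV Inr) ?R UNIV"
    by (rule bij_betw_inv_into)
  have zero: "?t p = 0" if p: "p permutes UNIV" "\<not> p permutes ?R" for p
  proof -
    have "\<exists>i. i \<notin> ?R \<and> p i \<noteq> i"
      using p unfolding permutes_def by auto
    then obtain i where i: "i \<notin> ?R" "p i \<noteq> i" by blast
    then obtain k where k: "i = Inl k" by (cases i) auto
    have "?A $ i $ p i = 0"
      using i(2) unfolding k block_diag_def by (auto simp: mat_def split: sum.split)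
    then have "(\<Prod>i\<in>UNIV. ?A $ i $ p i) = 0"
      by (intro prod_zero) auto
    then show ?thesis by simp
  qed
  have "det ?A = (\<Sum>p | p permutes ?R. ?t p)"
    unfolding det_def
    by (rule sum.mono_neutral_right) (auto simp: finite_permutations zero permutes_subset)
  also have "\<dots> = (\<Sum>q | q permutes UNIV. of_int (sign q) * (\<Prod>j\<in>UNIV. C $ j $ q j))"
  \<comment> \<open>\<open>?m\<close> and \<open>?m'\<close> transport permutations along
    \<open>Inr\<close> and its inverse; this preserves the sign, and the fixed \<open>Inl\<close>
    indices contribute factors 1.\<close>
  proof (rule sum.reindex_bij_witness[where i = ?m and j = ?m'])
    fix p assume "p \<in> {p. p permutes ?R}"
    then have p: "p permutes ?R" by simp
    show "?m (?m' p) = p"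
      by (rule map_permutation_compose_inv[OF bij' p]) (auto simp: f_inv_into_f)
    then have eq: "?m (?m' p) = p" .
    show m': "?m' p \<in> {q. q permutes UNIV}"
      using map_permutation_permutes[OF bij' p] by simp
    have "sign (?m (?m' p)) = sign (?m' p)"
      by (rule sign_map_permutation) (use m' in auto)
    then have sgn: "sign (?m' p) = sign p"
      by (simp add: eq)
    have "p (Inl k) = Inl k" for k
      using p by (auto simp: permutes_def)
    moreover have "p (Inr k) = Inr (?m' p k)" for k
      using map_permutation_apply[of "Inr :: 'b \<Rightarrow> 'a + 'b" UNIV k "?m' p"] unfolding eq by simp
    ultimately have "(\<Prod>i\<in>UNIV. ?A $ i $ p i) = (\<Prod>j\<in>UNIV. C $ j $ ?m' p j)"
      by (simp add: prod_sum_type block_diag_def mat_def)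
    with sgn show "of_int (sign (?m' p)) * (\<Prod>j\<in>UNIV. C $ j $ ?m' p j) = ?t p"
      by simp
  next
    fix q :: "'b \<Rightarrow> 'b" assume "q \<in> {q. q permutes UNIV}"
    then have q: "q permutes UNIV" by simp
    show "?m' (?m q) = q"
      by (rule map_permutation_compose_inv[OF bij q]) auto
    show "?m q \<in> {p. p permutes ?R}"
      using map_permutation_permutes[OF bij q] by simp
  qed
  finally show ?thesis by (simp add: det_def)
qed

text \<open>The shape of the moment matrix of a regressor with intercept: \<open>u\<close> stands
  for the mean of the other coordinates, \<open>S\<close> for their second moments.\<close>

definition bordered :: "real ^ 's \<Rightarrow> real ^ 's ^ 's \<Rightarrow> real ^ (1 + 's) ^ (1 + 's)" where
  "bordered u S = (\<chi> i j. case (i, j) of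
       (Inl _, Inl _) \<Rightarrow> 1
     | (Inl _, Inr l) \<Rightarrow> u $ l
     | (Inr k, Inl _) \<Rightarrow> u $ k
     | (Inr k, Inr l) \<Rightarrow> S $ k $ l)"

text \<open>Completing the square: the matrix is congruent to \<open>?B\<close> through a unit upper
  triangular matrix, whose determinant is 1.\<close>

lemma det_bordered:
  fixes u :: "real ^ 's" and S :: "real ^ 's ^ 's"
  shows "det (bordered u S) = det (S - outer u u)"
proof -
  let ?B = "block_diag (mat 1 :: real ^ 1 ^ 1) (S - outer u u)"
  define v :: "real ^ (1 + 's)" where
    "v = (\<Sum>j\<in>UNIV. (u $ j) *\<^sub>R row (Inr j) (mat 1))"
  \<comment> \<open>\<open>U\<close> is the identity with first row \<open>(1, u)\<close>. Writing
    that row as a unit row plus a combination of the others makes \<open>det_row_span\<close>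
    applicable.\<close>
  define U :: "real ^ (1 + 's) ^ (1 + 's)" where
    "U = (\<chi> k. if k = Inl 1 then row (Inl 1) (mat 1) + v else row k (mat 1))"
  have v: "v $ i = (case i of Inl _ \<Rightarrow> 0 | Inr j \<Rightarrow> u $ j)" for i
    by (cases i) (auto simp: v_def row_def mat_def if_distrib cong: if_cong)
  have "v \<in> span {row j (mat 1) |j. j \<noteq> Inl 1}"
    unfolding v_def by (intro span_sum span_scale span_base) blast
  then have "v \<in> vec.span {row j (mat 1) |j. j \<noteq> Inl 1}"
    by (simp add: span_vec_eq)
  then have "det U = det (mat 1 :: real ^ (1 + 's) ^ (1 + 's))"
    unfolding U_def by (rule det_row_span)
  then have det_U: "det U = 1" by simp
  have U: "U $ i $ j = (case (i, j) of
       (Inl _, Inl _) \<Rightarrow> 1 | (Inl _, Inr l) \<Rightarrow> u $ l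
     | (Inr k, Inl _) \<Rightarrow> 0 | (Inr k, Inr l) \<Rightarrow> if k = l then 1 else 0)" for i j
    by (auto simp: U_def v row_def mat_def split: sum.split)
  have "bordered u S = transpose U ** ?B ** U"
    unfolding vec_eq_iff
  proof (intro allI)
    fix i j
    show "bordered u S $ i $ j = (transpose U ** ?B ** U) $ i $ j"
      by (cases i; cases j)
        (simp_all add: bordered_def matrix_matrix_mult_def transpose_def U block_diag_def
          outer_def mat_def sum_sum_type if_distrib if_distribR cong: if_cong)
  qed
  then have "det (bordered u S) = det (transpose U) * det ?B * det U"
    by (simp add: det_mul)
  then show ?thesis
    by (simp add: det_U det_transpose det_block_diag_mat_1)
qed

lemma det_scaleR:
  fixes A :: "real ^ 'n ^ 'n"
  shows "det (c *\<^sub>R A) = c ^ CARD('n) * det A"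
proof -
  have "c *\<^sub>R A = matrix ((*\<^sub>R) c) ** A"
    by (simp add: matrix_scaleR vec_eq_iff matrix_matrix_mult_def mat_def if_distrib if_distribR cong: if_cong)
  then show ?thesis
    by (simp add: det_mul det_matrix_scaleR)
qed

section \<open>Inner inverses and the correction term of the Schur complement\<close>

lemma matrix_inv_right:
  fixes A :: "real ^ 'n ^ 'n"
  assumes "invertible A"
  shows "A ** matrix_inv A = mat 1"
proof -
  from assms have "\<exists>B. A ** B = mat 1 \<and> B ** A = mat 1"
    by (simp add: invertible_def)
  then have "A ** matrix_inv A = mat 1 \<and> matrix_inv A ** A = mat 1"
    unfolding matrix_inv_def by (rule someI_ex)
  then show ?thesis ..
qed

text \<open>Row and column \<open>Inr 1\<close> of the block matrix contain only \<open>c\<close>,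
  so this entry of the triple product is \<open>c * G $ Inr 1 $ Inr 1 * c\<close>. The entry is thus
  determined even when \<open>M\<close> is singular.\<close>

lemma inner_inverse_block_diag_entry:
  fixes M :: "real ^ 'm ^ 'm" and G :: "real ^ ('m + 1) ^ ('m + 1)"
  assumes "block_diag M (mat c) ** G ** block_diag M (mat c) = block_diag M (mat c)" and "c \<noteq> 0"
  shows "G $ Inr 1 $ Inr 1 = 1 / c"
proof -
  have "(block_diag M (mat c) ** G ** block_diag M (mat c)) $ Inr 1 $ Inr 1
      = block_diag M (mat c :: real ^ 1 ^ 1) $ Inr 1 $ Inr 1"
    by (simp only: assms)
  then have "c * G $ Inr 1 $ Inr 1 * c = c"
    by (simp add: matrix_matrix_mult_def block_diag_def sum_sum_type mat_def)
  with \<open>c \<noteq> 0\<close> show ?thesis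
    by (simp add: field_simps)
qed

lemma vstack_rowvector_sandwich:
  fixes r :: "real ^ 's" and G :: "real ^ ('m::finite + 1) ^ ('m + 1)"
  shows "transpose (vstack 0 (rowvector r)) ** G ** vstack 0 (rowvector r)
    = G $ Inr 1 $ Inr 1 *\<^sub>R outer r r"
  by (simp add: vec_eq_iff matrix_matrix_mult_def transpose_def vstack_def rowvector_def
      outer_def sum_sum_type mult_ac)

section \<open>Both criteria in terms of the gradient of \<open>ln h\<close>\<close>

lemma gradient_ln:
  assumes "f a > 0" and "has_gradient_at f a"
  shows "gradient (\<lambda>g. ln (f g)) a = (1 / f a) *\<^sub>R gradient f a"
proof -
  have "deriv (\<lambda>t. ln (f (a + t *\<^sub>R axis j 1))) 0 = deriv (\<lambda>t. f (a + t *\<^sub>R axis j 1)) 0 / f a" for j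
  proof (rule DERIV_imp_deriv)
    have "((\<lambda>t. f (a + t *\<^sub>R axis j 1)) has_real_derivative deriv (\<lambda>t. f (a + t *\<^sub>R axis j 1)) 0) (at 0)"
      using assms(2) unfolding has_gradient_at_def
      by (simp add: DERIV_deriv_iff_real_differentiable)
    then show "((\<lambda>t. ln (f (a + t *\<^sub>R axis j 1))) has_real_derivative
        deriv (\<lambda>t. f (a + t *\<^sub>R axis j 1)) 0 / f a) (at 0)"
      using assms(1) by (auto intro!: derivative_eq_intros simp: field_simps)
  qed
  then show ?thesis
    by (simp add: gradient_def partial_deriv_def vec_eq_iff)
qed

text \<open>The corner entry 1 is the total mass of the design, a finite sum because the support is
  finite.\<close>

lemma moment_matrix_aux_regressor:
  fixes h :: "real ^ 'p \<Rightarrow> real ^ 's \<Rightarrow> real" and \<gamma> :: "real ^ 's"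
  assumes "\<xi> \<in> designs X"
  defines "g \<equiv> \<lambda>x. gradient (\<lambda>c. ln (h x c)) \<gamma>"
  shows "moment_matrix (aux_regressor h \<gamma>) \<xi>
    = bordered (\<Sum>x\<in>set_pmf \<xi>. pmf \<xi> x *\<^sub>R g x) (\<Sum>x\<in>set_pmf \<xi>. pmf \<xi> x *\<^sub>R outer (g x) (g x))"
proof -
  have "(\<Sum>x\<in>set_pmf \<xi>. pmf \<xi> x) = 1"
    using assms(1) by (intro sum_pmf_eq_1) (auto simp: designs_def)
  then show ?thesis
    unfolding vec_eq_iff
    by (auto simp: moment_matrix_def bordered_def aux_regressor_def outer_def g_def split: sum.split)
qed

text \<open>Up to the factor 1/2, this is the covariance matrix of \<open>g\<close> under the
  design. The inverse is constrained only at the matrix of this one design, so the result serves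
  both \<open>matrix_inv\<close> on regular designs and generalized inverses on all designs.\<close>

lemma info22_1_eq:
  fixes h :: "real ^ 'p \<Rightarrow> real ^ 's \<Rightarrow> real" and \<mu> :: "real ^ 'p \<Rightarrow> real ^ 'm \<Rightarrow> real"
    and G :: "real ^ ('m + 1) ^ ('m + 1) \<Rightarrow> real ^ ('m + 1) ^ ('m + 1)"
    and \<gamma> :: "real ^ 's"
  assumes \<xi>: "\<xi> \<in> designs X"
    and pos: "\<And>x. x \<in> X \<Longrightarrow> h x \<gamma> > 0" and "\<sigma> > 0"
    and grad: "\<And>x. x \<in> X \<Longrightarrow> has_gradient_at (h x) \<gamma>"
    and G: "info11 \<mu> h \<beta> \<sigma> \<gamma> \<xi> ** G (info11 \<mu> h \<beta> \<sigma> \<gamma> \<xi>) ** info11 \<mu> h \<beta> \<sigma> \<gamma> \<xi>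
      = info11 \<mu> h \<beta> \<sigma> \<gamma> \<xi>"
  defines "g \<equiv> \<lambda>x. gradient (\<lambda>c. ln (h x c)) \<gamma>"
  defines "u \<equiv> \<Sum>x\<in>set_pmf \<xi>. pmf \<xi> x *\<^sub>R g x"
  shows "info22_1 G \<mu> h \<beta> \<sigma> \<gamma> \<xi>
    = (1/2) *\<^sub>R ((\<Sum>x\<in>set_pmf \<xi>. pmf \<xi> x *\<^sub>R outer (g x) (g x)) - outer u u)"
proof -
  have g: "gradient (h x) \<gamma> = h x \<gamma> *\<^sub>R g x \<and> h x \<gamma> > 0" if "x \<in> set_pmf \<xi>" for x
    using that \<xi> pos[of x] grad[of x] by (auto simp: g_def gradient_ln designs_def)
  have r: "(\<Sum>x\<in>set_pmf \<xi>. (pmf \<xi> x / (2 * \<sigma>\<^sup>2 * h x \<gamma>)) *\<^sub>R gradient (h x) \<gamma>) = (1 / (2 * \<sigma>\<^sup>2)) *\<^sub>R u"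
    unfolding u_def scaleR_sum_right
    by (intro sum.cong refl) (use g in \<open>force simp: field_simps\<close>)
  have i22: "info22 h \<gamma> \<xi> = (1/2) *\<^sub>R (\<Sum>x\<in>set_pmf \<xi>. pmf \<xi> x *\<^sub>R outer (g x) (g x))"
    unfolding info22_def scaleR_sum_right
  proof (intro sum.cong refl)
    fix x assume "x \<in> set_pmf \<xi>"
    then show "(pmf \<xi> x / (2 * (h x \<gamma>)\<^sup>2)) *\<^sub>R outer (gradient (h x) \<gamma>) (gradient (h x) \<gamma>)
      = (1/2) *\<^sub>R pmf \<xi> x *\<^sub>R outer (g x) (g x)"
      using g[of x] by (simp add: outer_def vec_eq_iff power2_eq_square)
  qed
  have "G (info11 \<mu> h \<beta> \<sigma> \<gamma> \<xi>) $ Inr 1 $ Inr 1 = 2 * \<sigma> ^ 4"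
    using inner_inverse_block_diag_entry[OF G[unfolded info11_def]] \<open>\<sigma> > 0\<close>
    by (simp add: info11_def)
  \<comment> \<open>The powers of \<open>\<sigma>\<close> cancel: the coefficient of
    \<open>outer u u\<close> is \<open>2 * \<sigma> ^ 4\<close> times the square of
    \<open>1 / (2 * \<sigma>\<^sup>2)\<close>, that is 1/2.\<close>
  then show ?thesis
    using \<open>\<sigma> > 0\<close>
    unfolding info22_1_def info12_def vstack_rowvector_sandwich r i22
    by (simp add: vec_eq_iff outer_def field_simps eval_nat_numeral)
qed

lemma det_info22_1_eq_det_moment_matrix:
  fixes h :: "real ^ 'p \<Rightarrow> real ^ 's \<Rightarrow> real" and \<mu> :: "real ^ 'p \<Rightarrow> real ^ 'm \<Rightarrow> real"
    and G :: "real ^ ('m + 1) ^ ('m + 1) \<Rightarrow> real ^ ('m + 1) ^ ('m + 1)"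
    and \<gamma> :: "real ^ 's"
  assumes "\<xi> \<in> designs X"
    and "\<And>x. x \<in> X \<Longrightarrow> h x \<gamma> > 0" and "\<sigma> > 0"
    and "\<And>x. x \<in> X \<Longrightarrow> has_gradient_at (h x) \<gamma>"
    and "info11 \<mu> h \<beta> \<sigma> \<gamma> \<xi> ** G (info11 \<mu> h \<beta> \<sigma> \<gamma> \<xi>) ** info11 \<mu> h \<beta> \<sigma> \<gamma> \<xi>
      = info11 \<mu> h \<beta> \<sigma> \<gamma> \<xi>"
  shows "det (info22_1 G \<mu> h \<beta> \<sigma> \<gamma> \<xi>)
    = (1/2) ^ CARD('s) * det (moment_matrix (aux_regressor h \<gamma>) \<xi>)"
  by (subst info22_1_eq[where X = X])
    (use assms in \<open>simp_all add: moment_matrix_aux_regressor[OF assms(1)] det_bordered det_scaleR\<close>)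

section \<open>Mixtures of designs\<close>

text \<open>A convex combination for \<open>t\<close> in [0, 1], encoded as a coin toss so that it
  is a \<open>pmf\<close> by construction.\<close>

definition mix_pmf :: "real \<Rightarrow> 'a pmf \<Rightarrow> 'a pmf \<Rightarrow> 'a pmf" where
  "mix_pmf t p q = bernoulli_pmf t \<bind> (\<lambda>b. if b then p else q)"

lemma pmf_mix_pmf:
  assumes "0 \<le> t" "t \<le> 1"
  shows "pmf (mix_pmf t p q) x = t * pmf p x + (1 - t) * pmf q x"
  using assms by (simp add: mix_pmf_def pmf_bind)

lemma set_pmf_mix_pmf:
  assumes "0 < t" "t < 1"
  shows "set_pmf (mix_pmf t p q) = set_pmf p \<union> set_pmf q"
  using assms by (auto simp: mix_pmf_def UNIV_bool)

lemma mix_pmf_in_designs: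
  assumes "0 < t" "t < 1" "p \<in> designs X" "q \<in> designs X"
  shows "mix_pmf t p q \<in> designs X"
  using assms by (simp add: designs_def set_pmf_mix_pmf)

text \<open>Points off the support have mass 0. A common index set allows moment matrices of
  different designs to be added.\<close>

lemma moment_matrix_superset:
  assumes "finite S" "set_pmf \<xi> \<subseteq> S"
  shows "moment_matrix f \<xi> = (\<Sum>x\<in>S. pmf \<xi> x *\<^sub>R outer (f x) (f x))"
  unfolding moment_matrix_def
  by (rule sum.mono_neutral_left) (use assms in \<open>auto simp: set_pmf_iff\<close>)

lemma moment_matrix_mix_pmf:
  assumes "0 < t" "t < 1" "p \<in> designs X" "q \<in> designs X"
  shows "moment_matrix f (mix_pmf t p q) = t *\<^sub>R moment_matrix f p + (1 - t) *\<^sub>R moment_matrix f q"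
proof -
  let ?S = "set_pmf p \<union> set_pmf q"
  have fin: "finite ?S" using assms by (simp add: designs_def)
  show ?thesis
    using assms
    by (subst (1 2 3) moment_matrix_superset[OF fin])
      (auto simp: set_pmf_mix_pmf pmf_mix_pmf scaleR_sum_right sum.distrib[symmetric] algebra_simps)
qed

section \<open>Regular designs and their density among all designs\<close>

text \<open>The \<open>\<beta>\<close> block is a Gram matrix with positive weights, so its kernel
  is the orthogonal complement of the gradients at the support points. It depends on the support
  alone, not on the weights.\<close>

lemma info11_kernel_iff:
  fixes h :: "real ^ 'p \<Rightarrow> real ^ 's \<Rightarrow> real" and \<mu> :: "real ^ 'p \<Rightarrow> real ^ 'm \<Rightarrow> real"
  assumes \<xi>: "\<xi> \<in> designs X"
    and pos: "\<And>x. x \<in> X \<Longrightarrow> h x \<gamma> > 0" and "\<sigma> > 0"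
  shows "info11 \<mu> h \<beta> \<sigma> \<gamma> \<xi> *v v = 0 \<longleftrightarrow>
    v $ Inr 1 = 0 \<and> (\<forall>x\<in>set_pmf \<xi>. gradient (\<mu> x) \<beta> \<bullet> (\<chi> k. v $ Inl k) = 0)"
    (is "_ \<longleftrightarrow> _ \<and> (\<forall>x\<in>_. ?d x \<bullet> ?w = 0)")
proof -
  let ?c = "\<lambda>x. pmf \<xi> x / (\<sigma>\<^sup>2 * h x \<gamma>)"
  have fin: "finite (set_pmf \<xi>)" and c: "x \<in> set_pmf \<xi> \<Longrightarrow> ?c x > 0" for x
    using \<xi> pos[of x] \<open>\<sigma> > 0\<close> by (auto simp: designs_def pmf_positive)
  have M: "info_beta \<mu> h \<beta> \<sigma> \<gamma> \<xi> *v w = (\<Sum>x\<in>set_pmf \<xi>. (?c x * (?d x \<bullet> w)) *\<^sub>R ?d x)" for w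
    unfolding vec_eq_iff matrix_vector_mult_def info_beta_def
    by (simp add: outer_def inner_vec_def sum_distrib_left sum_distrib_right sum_divide_distrib
        mult_ac) (rule allI, rule sum.swap)
  have split: "info11 \<mu> h \<beta> \<sigma> \<gamma> \<xi> *v v = 0 \<longleftrightarrow>
      v $ Inr 1 = 0 \<and> info_beta \<mu> h \<beta> \<sigma> \<gamma> \<xi> *v ?w = 0"
    using \<open>\<sigma> > 0\<close>
    by (auto simp: vec_eq_iff matrix_vector_mult_def info11_def block_diag_def sum_sum_type mat_def
        split_sum_all)
  have "\<forall>x\<in>set_pmf \<xi>. ?d x \<bullet> ?w = 0" if "info_beta \<mu> h \<beta> \<sigma> \<gamma> \<xi> *v ?w = 0"
  proof -
    \<comment> \<open>The quadratic form is a sum of nonnegative terms, so if it vanishes, each term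
      does.\<close>
    have "(\<Sum>x\<in>set_pmf \<xi>. ?c x * (?d x \<bullet> ?w)\<^sup>2) = (info_beta \<mu> h \<beta> \<sigma> \<gamma> \<xi> *v ?w) \<bullet> ?w"
      by (simp add: M inner_sum_left power2_eq_square mult_ac)
    also have "\<dots> = 0" by (simp add: that)
    finally have "\<forall>x\<in>set_pmf \<xi>. ?c x * (?d x \<bullet> ?w)\<^sup>2 = 0"
      using fin by (subst (asm) sum_nonneg_eq_0_iff)
        (blast intro: mult_nonneg_nonneg zero_le_power2 less_imp_le[OF c])+
    then show ?thesis
      using c by fastforce
  qed
  moreover have "info_beta \<mu> h \<beta> \<sigma> \<gamma> \<xi> *v ?w = 0" if "\<forall>x\<in>set_pmf \<xi>. ?d x \<bullet> ?w = 0"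
    using that by (simp add: M)
  ultimately show ?thesis
    unfolding split by blast
qed

text \<open>Enlarging the support can only shrink the kernel, and a square matrix with trivial
  kernel is invertible.\<close>

lemma regular_designs_mono:
  fixes h :: "real ^ 'p \<Rightarrow> real ^ 's \<Rightarrow> real" and \<mu> :: "real ^ 'p \<Rightarrow> real ^ 'm \<Rightarrow> real"
  assumes \<xi>: "\<xi> \<in> regular_designs X \<mu> h \<beta> \<sigma> \<gamma>" and \<eta>: "\<eta> \<in> designs X"
    and sub: "set_pmf \<xi> \<subseteq> set_pmf \<eta>"
    and pos: "\<And>x. x \<in> X \<Longrightarrow> h x \<gamma> > 0" and "\<sigma> > 0"
  shows "\<eta> \<in> regular_designs X \<mu> h \<beta> \<sigma> \<gamma>"
proof -
  have \<xi>_design: "\<xi> \<in> designs X" and inv: "invertible (info11 \<mu> h \<beta> \<sigma> \<gamma> \<xi>)"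
    using \<xi> by (auto simp: regular_designs_def)
  have kernel: "info11 \<mu> h \<beta> \<sigma> \<gamma> \<zeta> *v v = 0 \<longleftrightarrow>
      v $ Inr 1 = 0 \<and> (\<forall>x\<in>set_pmf \<zeta>. gradient (\<mu> x) \<beta> \<bullet> (\<chi> k. v $ Inl k) = 0)"
    if "\<zeta> \<in> designs X" for \<zeta> v
    using that pos \<open>\<sigma> > 0\<close> by (rule info11_kernel_iff)
  have "v = 0" if "info11 \<mu> h \<beta> \<sigma> \<gamma> \<eta> *v v = 0" for v
  proof -
    have "info11 \<mu> h \<beta> \<sigma> \<gamma> \<xi> *v v = 0"
      using that sub unfolding kernel[OF \<eta>] kernel[OF \<xi>_design] by blast
    with inv show ?thesis
      unfolding invertible_left_inverse matrix_left_invertible_ker by blast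
  qed
  with \<eta> show ?thesis
    by (auto simp: regular_designs_def invertible_left_inverse matrix_left_invertible_ker)
qed

text \<open>An arbitrary design is a limit of regular ones, namely of its mixtures with a fixed regular
  design, so that restricting the competitors to regular designs does not lower the maximum.\<close>

lemma det_moment_matrix_le_of_regular:
  fixes h :: "real ^ 'p \<Rightarrow> real ^ 's \<Rightarrow> real" and \<mu> :: "real ^ 'p \<Rightarrow> real ^ 'm \<Rightarrow> real"
  assumes \<xi>: "\<xi> \<in> regular_designs X \<mu> h \<beta> \<sigma> \<gamma>" and \<eta>: "\<eta> \<in> designs X"
    and pos: "\<And>x. x \<in> X \<Longrightarrow> h x \<gamma> > 0" and "\<sigma> > 0"
    and bound: "\<And>\<eta>. \<eta> \<in> regular_designs X \<mu> h \<beta> \<sigma> \<gamma> \<Longrightarrow> det (moment_matrix f \<eta>) \<le> b"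
  shows "det (moment_matrix f \<eta>) \<le> b"
proof -
  have \<xi>_design: "\<xi> \<in> designs X"
    using \<xi> by (simp add: regular_designs_def)
  let ?\<phi> = "\<lambda>t. det (t *\<^sub>R moment_matrix f \<xi> + (1 - t) *\<^sub>R moment_matrix f \<eta>)"
  have le: "?\<phi> t \<le> b" if t: "0 < t" "t < 1" for t
  proof -
    have "mix_pmf t \<xi> \<eta> \<in> regular_designs X \<mu> h \<beta> \<sigma> \<gamma>"
      using \<xi> mix_pmf_in_designs[OF t \<xi>_design \<eta>] _ pos \<open>\<sigma> > 0\<close>
      by (rule regular_designs_mono) (use t in \<open>simp add: set_pmf_mix_pmf\<close>)
    from bound[OF this] show ?thesis
      by (simp add: moment_matrix_mix_pmf[OF t \<xi>_design \<eta>])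
  qed
  \<comment> \<open>The determinant is a polynomial in \<open>t\<close>, and
    \<open>?\<phi> 0\<close> is the determinant for \<open>\<eta>\<close> itself; the bound on (0,
    1) passes to the limit from the right.\<close>
  have "isCont ?\<phi> 0"
    unfolding det_def by (intro continuous_intros)
  then have "(?\<phi> \<longlongrightarrow> ?\<phi> 0) (at_right 0)"
    unfolding isCont_def by (rule tendsto_within_subset) simp
  moreover have "eventually (\<lambda>t. ?\<phi> t \<le> b) (at_right 0)"
    using le by (intro eventually_at_rightI[of 0 1]) auto
  ultimately have "?\<phi> 0 \<le> b"
    by (intro tendsto_upperbound) auto
  then show ?thesis by simp
qed

theorem theorem1:
  fixes X :: "(real ^ 'p) set"
    and \<mu> :: "real ^ 'p \<Rightarrow> real ^ 'm \<Rightarrow> real"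
    and h :: "real ^ 'p \<Rightarrow> real ^ 's \<Rightarrow> real"
    and \<beta> :: "real ^ 'm" and \<sigma> :: real and \<gamma> :: "real ^ 's"
  assumes "compact X"
    and "continuous_on UNIV (\<lambda>(x, g). h x g)"
    and "\<And>x g. h x g > 0"
    and "\<sigma> > 0"
    and "\<And>x. x \<in> X \<Longrightarrow> has_gradient_at (\<mu> x) \<beta>"
    and "\<And>x. x \<in> X \<Longrightarrow> has_gradient_at (h x) \<gamma>"
  shows "(\<forall>\<xi> \<in> regular_designs X \<mu> h \<beta> \<sigma> \<gamma>.
            Ds_optimum matrix_inv (regular_designs X \<mu> h \<beta> \<sigma> \<gamma>) \<mu> h \<beta> \<sigma> \<gamma> \<xi>
              \<longleftrightarrow> D_optimum X (aux_regressor h \<gamma>) \<xi>)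
       \<and> (\<forall>G. generalized_inverse G \<longrightarrow>
            (\<forall>\<xi>. Ds_optimum G (designs X) \<mu> h \<beta> \<sigma> \<gamma> \<xi>
              \<longleftrightarrow> D_optimum X (aux_regressor h \<gamma>) \<xi>))"
proof -
  let ?R = "regular_designs X \<mu> h \<beta> \<sigma> \<gamma>"
  let ?D = "\<lambda>\<xi>. det (moment_matrix (aux_regressor h \<gamma>) \<xi>)"
  have det_eq: "det (info22_1 G \<mu> h \<beta> \<sigma> \<gamma> \<xi>) = (1/2) ^ CARD('s) * ?D \<xi>"
    if "\<xi> \<in> designs X" "info11 \<mu> h \<beta> \<sigma> \<gamma> \<xi> ** G (info11 \<mu> h \<beta> \<sigma> \<gamma> \<xi>) ** info11 \<mu> h \<beta> \<sigma> \<gamma> \<xi>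
      = info11 \<mu> h \<beta> \<sigma> \<gamma> \<xi>" for G \<xi>
    using that(1) assms(3,4,6) that(2) by (rule det_info22_1_eq_det_moment_matrix)
  \<comment> \<open>The factor is positive and the same for all designs, so it drops out of every
    comparison.\<close>
  have Ds_iff: "Ds_optimum G \<Xi> \<mu> h \<beta> \<sigma> \<gamma> \<xi> \<longleftrightarrow> \<xi> \<in> \<Xi> \<and> (\<forall>\<eta>\<in>\<Xi>. ?D \<eta> \<le> ?D \<xi>)"
    if "\<And>\<eta>. \<eta> \<in> \<Xi> \<Longrightarrow> det (info22_1 G \<mu> h \<beta> \<sigma> \<gamma> \<eta>) = (1/2) ^ CARD('s) * ?D \<eta>" for G \<Xi> \<xi>
    using that by (auto simp: Ds_optimum_def is_arg_max_linorder)
  have D_iff: "D_optimum X (aux_regressor h \<gamma>) \<xi> \<longleftrightarrow>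
      \<xi> \<in> designs X \<and> (\<forall>\<eta>\<in>designs X. ?D \<eta> \<le> ?D \<xi>)" for \<xi>
    by (auto simp: D_optimum_def is_arg_max_linorder)
  have regular: "det (info22_1 matrix_inv \<mu> h \<beta> \<sigma> \<gamma> \<xi>) = (1/2) ^ CARD('s) * ?D \<xi>"
    if "\<xi> \<in> ?R" for \<xi>
    using that by (intro det_eq) (auto simp: regular_designs_def matrix_inv_right)
  show ?thesis
  proof (intro conjI ballI allI impI)
    fix \<xi> assume \<xi>: "\<xi> \<in> ?R"
    \<comment> \<open>The two problems have different competitors here: regular designs on one side,
      all designs on the other. Approximation by regular mixtures, with \<open>\<xi>\<close> as the
      fixed regular design, bridges the gap.\<close>
    have "?D \<eta> \<le> ?D \<xi>" if "\<forall>\<zeta>\<in>?R. ?D \<zeta> \<le> ?D \<xi>" "\<eta> \<in> designs X" for \<eta>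
      using \<xi> that(2) assms(3,4) by (rule det_moment_matrix_le_of_regular) (use that(1) in auto)
    moreover have "Ds_optimum matrix_inv ?R \<mu> h \<beta> \<sigma> \<gamma> \<xi> \<longleftrightarrow> \<xi> \<in> ?R \<and> (\<forall>\<eta>\<in>?R. ?D \<eta> \<le> ?D \<xi>)"
      by (rule Ds_iff) (rule regular)
    ultimately show "Ds_optimum matrix_inv ?R \<mu> h \<beta> \<sigma> \<gamma> \<xi> \<longleftrightarrow> D_optimum X (aux_regressor h \<gamma>) \<xi>"
      using \<xi> unfolding D_iff by (auto simp: regular_designs_def)
  next
    fix G \<xi> assume "generalized_inverse (G :: real ^ ('m + 1) ^ ('m + 1) \<Rightarrow> _)"
    \<comment> \<open>With a generalized inverse both problems range over \<open>designs X\<close>,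
      so proportionality of the criteria suffices.\<close>
    then have "det (info22_1 G \<mu> h \<beta> \<sigma> \<gamma> \<eta>) = (1/2) ^ CARD('s) * ?D \<eta>" if "\<eta> \<in> designs X" for \<eta>
      using that by (intro det_eq) (auto simp: generalized_inverse_def)
    then show "Ds_optimum G (designs X) \<mu> h \<beta> \<sigma> \<gamma> \<xi> \<longleftrightarrow> D_optimum X (aux_regressor h \<gamma>) \<xi>"
      unfolding D_iff by (rule Ds_iff)
  qed
qed

end
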